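(* Let $\mathbf I=\mathrm{diag}(I_1,I_2,I_3)$ be the inertia tensor of an asymmetric satellite (with $I_1,I_2,I_3$ pairwise different, $0<I_i<\tfrac12$, $I_1+I_2+I_3=1$). Then there exist relative equilibria $((\mathrm{Id},\mathbf R),\xi)$ of the second order system, called conical relative equilibria, for which $\mathbf R$ and $\xi$ are neither parallel nor perpendicular. For every such relative equilibrium, $\mathbf R$ and $\xi$ both lie in one of the principal planes of $\mathbf I$ (a plane spanned by two coordinate axes). If the principal axes are ordered so that $\mathbf R$ and $\xi$ lie in the plane spanned by the first two, and $\mathbf R=(R\cos\psi,R\sin\psi,0)$ with $R=|\mathbf R|$, then $$A_4S^2+A_2S+A_0=0\quad\text{and}\quad \nabla_{\mathbf R}V_2(\mathbf R)\cdot\mathbf R>0,$$ where $S=\cos^2\psi$ and $$A_4=225(I_2-I_1)^2,\qquad A_2=6(I_2-I_1)(19R^2+15I_1-60I_2+15),$$ $$A_0=(2R^2-9I_2+3)(8R^2+6I_1-15I_2+3).$$ Moreover, writing $\nabla_{\mathbf R}V_2(\mathbf R)=(g_1,g_2,0)$, the associated angular velocity is $\xi=k^{-1}(-g_2,g_1,0)$, where $k\in\mathbb R$ satisfies $$k^2=\frac{|\mathbf R|^2\,|\nabla_{\mathbf R}V_2(\mathbf R)|^2-\big((g_2,-g_1,0)\cdot\mathbf R\big)^2}{\nabla_{\mathbf R}V_2(\mathbf R)\cdot\mathbf R}.$$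
   Context: Second order satellite model. Units are chosen so that the satellite has mass $1$ and its inertia tensor has trace $1$. The configuration space is $Q=SO(3)\times(\mathbb R^3\setminus\{0\})$ with points $(B,\mathbf R)$ in body coordinates: $B$ is the attitude and $\mathbf R=B^T\mathbf r$, where $\mathbf r$ is the position of the center of mass relative to the center of attraction. Tangent vectors are written $(\Omega,\dot{\mathbf R})\in\mathbb R^3\times\mathbb R^3$ with $\dot B=B\widehat\Omega$, where $\widehat\Omega u=\Omega\times u$. The kinetic energy is $K=\frac12(\Omega\cdot\mathbf I\Omega+|\dot{\mathbf R}+\Omega\times\mathbf R|^2)$, the potential is $$V_2(\mathbf R)=-\frac1R-\frac1{2R^3}+\frac{3}{2R^5}\,\mathbf R\cdot\mathbf I\mathbf R,\qquad R=|\mathbf R|,$$ and the system on $T^*Q$ has Hamiltonian $H_2=K+V_2$. Its gradient is $$\nabla_{\mathbf R}V_2(\mathbf R)=\frac{\mathbf R}{R^3}+\frac{3\mathbf R}{2R^5}+\frac{3\mathbf I\mathbf R}{R^5}-\frac{15\,\mathbf R(\mathbf R\cdot\mathbf I\mathbf R)}{2R^7}.$$ Symmetry and relative equilibria. $M\in SO(3)$ acts by $M\cdot(B,\mathbf R)=(MB,\mathbf R)$. A relative equilibrium with angular velocity $\xi\in\mathfrak{so}(3)\cong\mathbb R^3$ is a point of phase space whose evolution is $t\mapsto \exp(t\widehat\xi)\cdot p$; equivalently, it is given by a pair $((B,\mathbf R),\xi)$ such that $(B,\mathbf R)$ is a critical point of the augmented potential $V_\xi(B,\mathbf R)=V_2(\mathbf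 R)-\frac12\,\xi\cdot B(\mathbf I-\widehat{\mathbf R}\widehat{\mathbf R})B^T\xi$. By $SO(3)$-invariance one always normalizes $B=\mathrm{Id}$; then the conditions are $$\xi\times\big((\mathbf I-\mathbf R\mathbf R^T)\xi\big)=0,\qquad \nabla_{\mathbf R}V_2(\mathbf R)+\xi(\mathbf R\cdot\xi)-\mathbf R|\xi|^2=0.$$ The zero vector is regarded as parallel to every vector. *)

theory Defs
  imports "HOL-Analysis.Analysis"
begin

definition diag_matrix :: "real^'n \<Rightarrow> real^'n^'n" where
  "diag_matrix d = (\<chi> i j. if i = j then d $ i else 0)"

definition hat :: "real^3 \<Rightarrow> real^3^3" where
  "hat \<Omega> = matrix (\<lambda>u. cross3 \<Omega> u)"

definition grad :: "('a::real_inner \<Rightarrow> real) \<Rightarrow> 'a \<Rightarrow> 'a" where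
  "grad f x = (THE D. GDERIV f x :> D)"

definition config_space :: "((real^3^3) \<times> (real^3)) set" where
  "config_space = {B. rotation_matrix B} \<times> (UNIV - {0})"

definition V2 :: "real^3^3 \<Rightarrow> real^3 \<Rightarrow> real" where
  "V2 J R = - 1 / norm R - 1 / (2 * norm R ^ 3) + 3 / (2 * norm R ^ 5) * (R \<bullet> (J *v R))"

text \<open>The subtracted term is the kinetic energy of the rigid rotation with spatial angular
  velocity \<open>\<xi>\<close>; \<open>J - hat R ** hat R\<close> is the locked inertia tensor in body coordinates.\<close>

definition augmented_potential :: "real^3^3 \<Rightarrow> real^3 \<Rightarrow> (real^3^3) \<times> (real^3) \<Rightarrow> real" where
  "augmented_potential J \<xi> = (\<lambda>(B, R).
     V2 J R - 1/2 * (\<xi> \<bullet> ((B ** (J - hat R ** hat R) ** transpose B) *v \<xi>)))"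

text \<open>Critical points on the submanifold \<open>config_space\<close>. The function is given on a neighbourhood
  in the ambient space of all pairs (matrix, vector); a point is critical if the ambient derivative
  vanishes on the tangent space, which at \<open>(B, R)\<close> consists of the vectors \<open>(B ** hat \<Omega>, v)\<close>.\<close>

definition critical_on_config_space ::
    "((real^3^3) \<times> (real^3) \<Rightarrow> real) \<Rightarrow> (real^3^3) \<times> (real^3) \<Rightarrow> bool" where
  "critical_on_config_space f q \<longleftrightarrow> q \<in> config_space \<and>
     (\<exists>D. (f has_derivative D) (at q) \<and> (\<forall>\<Omega> v. D (fst q ** hat \<Omega>, v) = 0))"

definition relative_equilibrium :: "real^3^3 \<Rightarrow> (real^3^3) \<times> (real^3) \<Rightarrow> real^3 \<Rightarrow> bool" where
  "relative_equilibrium J q \<xi> \<longleftrightarrow> critical_on_config_space (augmented_potential J \<xi>) q"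

text \<open>\<open>collinear {0, R, \<xi>}\<close> says that \<open>R\<close> and \<open>\<xi>\<close> are parallel, the zero vector being parallel
  to every vector.\<close>

definition conical_relative_equilibrium :: "real^3^3 \<Rightarrow> real^3 \<Rightarrow> real^3 \<Rightarrow> bool" where
  "conical_relative_equilibrium J R \<xi> \<longleftrightarrow>
     relative_equilibrium J (mat 1, R) \<xi> \<and> \<not> collinear {0, R, \<xi>} \<and> \<not> orthogonal R \<xi>"

definition coordinate_plane :: "'n \<Rightarrow> 'n \<Rightarrow> (real^'n) set" where
  "coordinate_plane i j = span {axis i 1, axis j 1}"

end

theory Submission
  imports Defs
begin

text \<open>With \<open>c = R \<bullet> \<xi>\<close> and \<open>g\<close> the gradient of the potential, the equilibrium conditions read
  \<open>I \<xi> - c R = \<nu> \<xi>\<close> and \<open>g = |\<xi>|\<^sup>2 R - c \<xi>\<close>, where \<open>g = \<alpha> R + \<beta> I R\<close> with \<open>\<beta> \<noteq> 0\<close>. Eliminating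
  \<open>\<xi>\<close> shows that every principal moment \<open>I\<^sub>l\<close> with \<open>R\<^sub>l \<noteq> 0\<close> is a root of one quadratic polynomial;
  so at most two components of \<open>R\<close> are nonzero, and as \<open>c \<noteq> 0\<close> the vector \<open>\<xi>\<close> lies in the same
  plane. There \<open>\<xi>\<close> is orthogonal to \<open>g\<close>, which turns the conditions into
  \<open>(I\<^sub>2 - I\<^sub>1) g\<^sub>1 g\<^sub>2 = (g\<^sub>1 R\<^sub>2 - g\<^sub>2 R\<^sub>1) (g \<bullet> R)\<close> and \<open>g \<bullet> R > 0\<close>; the first one is a quadratic
  equation in \<open>cos\<^sup>2 \<psi>\<close>. Solutions are found by the intermediate value theorem in a plane of two axes
  whose moments lie on either side of \<open>1/3\<close>.\<close>

section \<open>Gradient of the second order potential\<close>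

text \<open>Explicit candidate for \<open>grad (V2 J) R\<close>, grouped into a multiple of
  \<open>R\<close> and a multiple of \<open>J *v R\<close>.\<close>

definition gradV2 :: "real^3^3 \<Rightarrow> real^3 \<Rightarrow> real^3" where
  "gradV2 J R = (1 / norm R ^ 3 + 3 / (2 * norm R ^ 5) - 15 * (R \<bullet> (J *v R)) / (2 * norm R ^ 7)) *\<^sub>R R
     + (3 / norm R ^ 5) *\<^sub>R (J *v R)"

lemma diag_matrix_mult_component: "(diag_matrix d *v x) $ i = d $ i * x $ i"
  by (simp add: diag_matrix_def matrix_vector_mult_def if_distrib[of "\<lambda>c. c * _"] cong: if_cong)

lemma transpose_diag_matrix: "transpose (diag_matrix d) = diag_matrix d"
  by (simp add: diag_matrix_def transpose_def vec_eq_iff)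

text \<open>Symmetry of \<open>J\<close> makes the two terms of the product rule equal, hence the
  factor 2.\<close>

lemma GDERIV_quadratic_form:
  fixes J :: "real^'n^'n"
  assumes "transpose J = J"
  shows "GDERIV (\<lambda>x. x \<bullet> (J *v x)) x :> 2 *\<^sub>R (J *v x)"
proof -
  have sym: "x \<bullet> (J *v h) = h \<bullet> (J *v x)" for h
    by (metis assms dot_lmul_matrix inner_commute transpose_matrix_vector)
  have "((*v) J has_derivative (*v) J) (at x)"
    by (intro bounded_linear_imp_has_derivative matrix_vector_mul_bounded_linear)
  from has_derivative_inner[OF has_derivative_ident this]
  show ?thesis
    unfolding gderiv_def by (rule has_derivative_eq_rhs) (simp add: sym fun_eq_iff)
qed

text \<open>The potential is a radial function plus a radial function times the quadratic form. Away
  from the origin the norm has gradient \<open>sgn R\<close>, so one-variable derivatives and the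
  chain and product rules suffice.\<close>

lemma GDERIV_V2:
  assumes J: "transpose J = J" and R: "R \<noteq> 0"
  shows "GDERIV (V2 J) R :> gradV2 J R"
proof -
  let ?r = "norm R"
  have r: "?r \<noteq> 0" using R by simp
  have 1: "DERIV (\<lambda>t. - 1 / t - 1 / (2 * t^3)) ?r :> 1 / ?r^2 + 3 / (2 * ?r^4)"
    using r by (auto intro!: derivative_eq_intros) (simp add: field_simps power_numeral_reduce)
  have 2: "DERIV (\<lambda>t. 3 / (2 * t^5)) ?r :> - 15 / (2 * ?r^6)"
    using r by (auto intro!: derivative_eq_intros) (simp add: field_simps power_numeral_reduce)
  have "GDERIV (\<lambda>R. (- 1 / norm R - 1 / (2 * norm R ^ 3)) + 3 / (2 * norm R ^ 5) * (R \<bullet> (J *v R))) R :>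
      (1 / ?r^2 + 3 / (2 * ?r^4)) *\<^sub>R sgn R
      + ((3 / (2 * ?r^5)) *\<^sub>R (2 *\<^sub>R (J *v R)) + (R \<bullet> (J *v R)) *\<^sub>R (- 15 / (2 * ?r^6)) *\<^sub>R sgn R)"
    by (intro GDERIV_add GDERIV_mult GDERIV_quadratic_form J
        GDERIV_DERIV_compose[OF GDERIV_norm[OF R] 1] GDERIV_DERIV_compose[OF GDERIV_norm[OF R] 2])
  moreover have "a *\<^sub>R sgn R + (b *\<^sub>R (2 *\<^sub>R y) + q *\<^sub>R c *\<^sub>R sgn R) =
      ((a + q * c) / ?r) *\<^sub>R R + (2 * b) *\<^sub>R y" for a b c q y
    by (simp add: sgn_div_norm divide_inverse algebra_simps)
  moreover have "(1 / ?r^2 + 3 / (2 * ?r^4) + R \<bullet> (J *v R) * (- 15 / (2 * ?r^6))) / ?r =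
      1 / ?r ^ 3 + 3 / (2 * ?r ^ 5) - 15 * (R \<bullet> (J *v R)) / (2 * ?r ^ 7)"
    by (simp add: add_divide_distrib diff_divide_distrib power_numeral_reduce ac_simps)
  moreover have "2 * (3 / (2 * ?r^5)) = 3 / ?r^5" by simp
  ultimately show ?thesis
    by (simp only: V2_def[abs_def] gradV2_def)
qed

text \<open>Uniqueness of derivatives makes the definite description in \<open>grad\<close> denote
  \<open>D\<close>.\<close>

lemma grad_eqI:
  assumes "GDERIV f x :> D"
  shows "grad f x = D"
  unfolding grad_def
proof (rule the_equality)
  show "GDERIV f x :> D" by (fact assms)
next
  fix E assume "GDERIV f x :> E"
  with assms have "(\<lambda>h. h \<bullet> D) = (\<lambda>h. h \<bullet> E)"
    unfolding gderiv_def by (rule has_derivative_unique)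
  then show "E = D" by (metis inner_commute vector_eq_rdot)
qed

section \<open>Critical points of the augmented potential\<close>

lemma hat_mult: "hat \<Omega> *v u = cross3 \<Omega> u"
  by (simp add: hat_def matrix_def matrix_vector_mult_def vec_eq_iff forall_3 cross3_simps axis_def)

lemma transpose_hat: "transpose (hat \<Omega>) = - hat \<Omega>"
  by (simp add: hat_def matrix_def transpose_def vec_eq_iff forall_3 cross3_simps axis_def)

lemma cross_triple: "cross3 x y \<bullet> z = x \<bullet> cross3 y z"
  by (simp add: cross3_simps)

text \<open>Passing to the body angular velocity \<open>transpose B *v \<xi>\<close> and expanding
  the double cross product leaves a polynomial kinetic term. \<open>B\<close> is an arbitrary matrix
  because the derivative is taken in the ambient space.\<close>

lemma augmented_potential_alt:
  "augmented_potential J \<xi> (B, R) = V2 J R - 1/2 * ((transpose B *v \<xi>) \<bullet> (J *v (transpose B *v \<xi>))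
     + (R \<bullet> R) * ((transpose B *v \<xi>) \<bullet> (transpose B *v \<xi>)) - (R \<bullet> (transpose B *v \<xi>))^2)"
proof -
  define w where "w = transpose B *v \<xi>"
  have "\<xi> \<bullet> ((B ** (J - hat R ** hat R) ** transpose B) *v \<xi>) = \<xi> \<bullet> (B *v ((J - hat R ** hat R) *v w))"
    by (simp only: w_def matrix_vector_mul_assoc matrix_mul_assoc)
  also have "\<dots> = w \<bullet> (J *v w - cross3 R (cross3 R w))"
  proof -
    have "\<xi> \<bullet> (B *v y) = w \<bullet> y" for y by (simp add: w_def dot_lmul_matrix)
    then show ?thesis
      by (simp only: matrix_vector_mult_diff_rdistrib matrix_vector_mul_assoc[symmetric] hat_mult)
  qed
  also have "\<dots> = w \<bullet> (J *v w) + (R \<bullet> R) * (w \<bullet> w) - (R \<bullet> w)^2"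
    by (simp add: inner_diff_right, simp add: cross3_simps power2_eq_square)
  finally show ?thesis by (simp add: augmented_potential_def w_def)
qed

text \<open>On a tangent vector \<open>(hat \<Omega>, v)\<close> the derivative equals
  \<open>v \<bullet> G + \<Omega> \<bullet> T\<close>, where \<open>T\<close> and \<open>G\<close>
  are the residuals of the two vector equations: varying the attitude gives the first, varying
  \<open>R\<close> the second.\<close>

lemma relative_equilibrium_iff:
  assumes J: "transpose J = J"
  shows "relative_equilibrium J (mat 1, R) \<xi> \<longleftrightarrow> R \<noteq> 0 \<and>
    cross3 \<xi> (J *v \<xi> - (R \<bullet> \<xi>) *\<^sub>R R) = 0 \<and>
    gradV2 J R = (\<xi> \<bullet> \<xi>) *\<^sub>R R - (R \<bullet> \<xi>) *\<^sub>R \<xi>"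
proof (cases "R = 0")
  case True
  then show ?thesis
    by (simp add: relative_equilibrium_def critical_on_config_space_def config_space_def)
next
  case R: False
  define T where "T = cross3 \<xi> (J *v \<xi> - (R \<bullet> \<xi>) *\<^sub>R R)"
  define G where "G = gradV2 J R - ((\<xi> \<bullet> \<xi>) *\<^sub>R R - (R \<bullet> \<xi>) *\<^sub>R \<xi>)"
  define q :: "(real^3^3) \<times> (real^3)" where "q = (mat 1, R)"
  define w where "w = (\<lambda>p :: (real^3^3) \<times> (real^3). transpose (fst p) *v \<xi>)"
  have "linear w"
    by (rule linearI) (simp_all add: w_def matrix_vector_mult_def transpose_def vec_eq_iff
        algebra_simps sum.distrib sum_distrib_left)
  then have dw: "(w has_derivative w) (at q)"
    by (simp add: linear_imp_has_derivative)
  have wq: "w q = \<xi>" by (simp add: w_def q_def transpose_mat)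
  have dV: "((\<lambda>p. V2 J (snd p)) has_derivative (\<lambda>h. snd h \<bullet> gradV2 J R)) (at q)"
    using has_derivative_compose[OF has_derivative_snd[OF has_derivative_ident],
        of "V2 J" "\<lambda>h. h \<bullet> gradV2 J R" q] GDERIV_V2[OF J R]
    by (simp add: gderiv_def q_def)
  have dQ: "((\<lambda>p. w p \<bullet> (J *v w p)) has_derivative (\<lambda>h. w h \<bullet> (2 *\<^sub>R (J *v \<xi>)))) (at q)"
    using has_derivative_compose[OF dw, of "\<lambda>x. x \<bullet> (J *v x)" "\<lambda>h. h \<bullet> (2 *\<^sub>R (J *v \<xi>))"]
      GDERIV_quadratic_form[OF J, of \<xi>]
    by (simp add: gderiv_def wq)
  \<comment> \<open>The vector paired with \<open>w h\<close> is the locked inertia tensor at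
    \<open>R\<close> applied to \<xi>.\<close>
  define D where "D = (\<lambda>h. snd h \<bullet> G - w h \<bullet> (J *v \<xi> + (R \<bullet> R) *\<^sub>R \<xi> - (R \<bullet> \<xi>) *\<^sub>R R))"
  have dD: "(augmented_potential J \<xi> has_derivative D) (at q)"
  proof -
    have "augmented_potential J \<xi> = (\<lambda>p. V2 J (snd p) - 1/2 * (w p \<bullet> (J *v w p)
        + (snd p \<bullet> snd p) * (w p \<bullet> w p) - (snd p \<bullet> w p)^2))"
      by (simp add: fun_eq_iff augmented_potential_alt w_def)
    moreover have "((\<lambda>p. V2 J (snd p) - 1/2 * (w p \<bullet> (J *v w p)
        + (snd p \<bullet> snd p) * (w p \<bullet> w p) - (snd p \<bullet> w p)^2)) has_derivative D) (at q)"
      by (rule dV dQ dw refl derivative_eq_intros)+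
        (simp add: fun_eq_iff D_def G_def wq, simp add: q_def inner_diff_right inner_add_right inner_commute field_simps)
    ultimately show ?thesis by simp
  qed
  \<comment> \<open>Uniqueness of derivatives turns the existential in
    \<open>critical_on_config_space\<close> into a statement about \<open>D\<close>.\<close>
  have "E = D" if "(augmented_potential J \<xi> has_derivative E) (at q)" for E
    using that dD by (rule has_derivative_unique)
  then have "(\<exists>E. (augmented_potential J \<xi> has_derivative E) (at q) \<and> P E) \<longleftrightarrow> P D" for P
    using dD by blast
  moreover have "q \<in> config_space"
    using R by (simp add: config_space_def q_def rotation_matrix_def orthogonal_matrix_id)
  ultimately have "critical_on_config_space (augmented_potential J \<xi>) q \<longleftrightarrow>
      (\<forall>\<Omega> v. D (hat \<Omega>, v) = 0)"
    by (simp add: critical_on_config_space_def q_def)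
  moreover have "D (hat \<Omega>, v) = v \<bullet> G + \<Omega> \<bullet> T" for \<Omega> v
  proof -
    have "w (hat \<Omega>, v) = (- hat \<Omega>) *v \<xi>"
      by (simp only: w_def fst_conv transpose_hat)
    also have "\<dots> = - cross3 \<Omega> \<xi>"
      unfolding hat_mult[symmetric] by (simp add: matrix_vector_mult_def vec_eq_iff sum_negf)
    finally have "D (hat \<Omega>, v) = v \<bullet> G +
        cross3 \<Omega> \<xi> \<bullet> ((J *v \<xi> - (R \<bullet> \<xi>) *\<^sub>R R) + (R \<bullet> R) *\<^sub>R \<xi>)"
      by (simp add: D_def algebra_simps)
    \<comment> \<open>The multiple of \<xi> is orthogonal to \<open>cross3 \<Omega> \<xi>\<close>
      and drops out; the triple product then isolates \<Omega>.\<close>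
    then show ?thesis
      by (simp add: T_def inner_add_right cross_triple dot_cross_self)
  qed
  moreover have "(\<forall>\<Omega> v. v \<bullet> G + \<Omega> \<bullet> T = 0) \<longleftrightarrow> T = 0 \<and> G = 0"
  proof
    assume "\<forall>\<Omega> v. v \<bullet> G + \<Omega> \<bullet> T = 0"
    then have "0 \<bullet> G + T \<bullet> T = 0" "G \<bullet> G + 0 \<bullet> T = 0" by blast+
    then show "T = 0 \<and> G = 0" by simp
  qed simp
  ultimately show ?thesis
    using R by (simp add: relative_equilibrium_def q_def T_def G_def)
qed


section \<open>Coordinate planes\<close>

lemma mem_coordinate_plane_iff:
  "x \<in> coordinate_plane i j \<longleftrightarrow> (\<forall>k. k \<noteq> i \<longrightarrow> k \<noteq> j \<longrightarrow> x $ k = 0)"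
proof
  assume "x \<in> coordinate_plane i j"
  then obtain a b where "x - a *\<^sub>R axis i 1 = b *\<^sub>R axis j 1"
    by (auto simp: coordinate_plane_def span_insert span_singleton)
  then have "x = a *\<^sub>R axis i 1 + b *\<^sub>R axis j 1"
    by (simp add: algebra_simps)
  then show "\<forall>k. k \<noteq> i \<longrightarrow> k \<noteq> j \<longrightarrow> x $ k = 0"
    by (simp add: axis_def)
next
  assume "\<forall>k. k \<noteq> i \<longrightarrow> k \<noteq> j \<longrightarrow> x $ k = 0"
  \<comment> \<open>For \<open>i = j\<close> the two axis vectors coincide, so the second
    coefficient is 0 to avoid counting the component twice.\<close>
  then have "x = x $ i *\<^sub>R axis i 1 + (if i = j then 0 else x $ j) *\<^sub>R axis j 1"
    by (auto simp: vec_eq_iff axis_def)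
  moreover have "\<dots> \<in> coordinate_plane i j"
    unfolding coordinate_plane_def by (intro span_add span_scale span_base) auto
  ultimately show "x \<in> coordinate_plane i j" by simp
qed

lemma coordinate_plane_expand:
  assumes "i \<noteq> j" "x \<in> coordinate_plane i j"
  shows "x = x $ i *\<^sub>R axis i 1 + x $ j *\<^sub>R axis j 1"
  using assms by (auto simp: mem_coordinate_plane_iff vec_eq_iff axis_def)

lemma inner_coordinate_plane:
  fixes x y :: "real^'n"
  assumes "i \<noteq> j" "x \<in> coordinate_plane i j"
  shows "x \<bullet> y = x $ i * y $ i + x $ j * y $ j"
  by (subst coordinate_plane_expand[OF assms]) (simp add: inner_add_left inner_axis')

lemma coordinate_plane_eqI:
  assumes "x \<in> coordinate_plane i j" "y \<in> coordinate_plane i j" "x $ i = y $ i" "x $ j = y $ j"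
  shows "x = y"
  using assms by (force simp: mem_coordinate_plane_iff vec_eq_iff)

lemma cross3_eq_0_iff: "cross3 x y = 0 \<longleftrightarrow> (\<forall>i j. x $ i * y $ j = x $ j * y $ i)"
  by (auto simp: cross3_simps forall_3)

text \<open>Only the component of the cross product normal to the plane can be nonzero, so one
  scalar equation suffices.\<close>

lemma cross3_eq_0_iff_coordinate_plane:
  assumes "i \<noteq> j" "x \<in> coordinate_plane i j" "y \<in> coordinate_plane i j"
  shows "cross3 x y = 0 \<longleftrightarrow> x $ i * y $ j = x $ j * y $ i"
  using assms unfolding cross3_eq_0_iff mem_coordinate_plane_iff
  by (metis mult.commute mult_zero_left)

section \<open>Conical equilibria lie in principal planes\<close>

text \<open>With the quadratic form normalized to \<open>m\<close>, the factor multiplying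
  \<open>R $ l\<close> depends on the axis only through \<open>d $ l\<close>.\<close>

lemma gradV2_diag_component:
  assumes "R \<noteq> 0" and "R \<bullet> (diag_matrix d *v R) = (norm R)^2 * m"
  shows "gradV2 (diag_matrix d) R $ l = ((norm R)^2 + 3/2 - 15/2 * m + 3 * d $ l) / norm R ^ 5 * R $ l"
  using assms by (simp add: gradV2_def diag_matrix_mult_component field_simps power_numeral_reduce)

lemma gradV2_diag_coordinate_plane:
  assumes "R \<in> coordinate_plane i j"
  shows "gradV2 (diag_matrix d) R \<in> coordinate_plane i j"
  using assms by (simp add: mem_coordinate_plane_iff gradV2_def diag_matrix_mult_component)

text \<open>Componentwise the conditions become the linear relations \<open>cR\<close> and
  \<open>c\<xi>\<close>. Eliminating \<xi> yields a quadratic with leading coefficient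
  \<open>- \<beta>\<close>, which cannot have three distinct moments as roots.\<close>

lemma conical_in_coordinate_plane:
  fixes d :: "real^3"
  assumes distinct: "d $ 1 \<noteq> d $ 2" "d $ 1 \<noteq> d $ 3" "d $ 2 \<noteq> d $ 3"
    and con: "conical_relative_equilibrium (diag_matrix d) R \<xi>"
  shows "\<exists>i j. i \<noteq> j \<and> R \<in> coordinate_plane i j \<and> \<xi> \<in> coordinate_plane i j"
proof -
  define c where "c = R \<bullet> \<xi>"
  have R: "R \<noteq> 0" and c: "c \<noteq> 0" and nc: "\<not> collinear {0, R, \<xi>}"
    and eq1: "cross3 \<xi> (diag_matrix d *v \<xi> - c *\<^sub>R R) = 0"
    and eq2: "gradV2 (diag_matrix d) R = (\<xi> \<bullet> \<xi>) *\<^sub>R R - c *\<^sub>R \<xi>"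
    using con unfolding conical_relative_equilibrium_def relative_equilibrium_iff[OF transpose_diag_matrix]
    by (auto simp: c_def orthogonal_def)
  have "\<xi> \<noteq> 0" using nc by (auto simp: collinear_lemma)
  \<comment> \<open>A vector collinear with the nonzero \<xi> is a multiple of it; the zero vector
    gives \<open>\<nu> = 0\<close>.\<close>
  then obtain \<nu> where "diag_matrix d *v \<xi> - c *\<^sub>R R = \<nu> *\<^sub>R \<xi>"
    using eq1 unfolding cross_eq_0 collinear_lemma by (metis scale_zero_left)
  then have "(diag_matrix d *v \<xi> - c *\<^sub>R R) $ l = (\<nu> *\<^sub>R \<xi>) $ l" for l by simp
  then have cR: "c * R $ l = (d $ l - \<nu>) * \<xi> $ l" for l
    by (simp add: diag_matrix_mult_component algebra_simps)
  define m where "m = R \<bullet> (diag_matrix d *v R) / (norm R)^2"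
  \<comment> \<open>\<beta> and \<mu> are chosen so that component \<open>l\<close> of the gradient
    is \<open>(\<xi> \<bullet> \<xi> - \<mu> + \<beta> * d $ l) * R $ l\<close>.\<close>
  define \<beta> where "\<beta> = 3 / norm R ^ 5"
  define \<mu> where "\<mu> = \<xi> \<bullet> \<xi> - ((norm R)^2 + 3/2 - 15/2 * m) / norm R ^ 5"
  have \<beta>: "\<beta> \<noteq> 0" using R by (simp add: \<beta>_def)
  have c\<xi>: "c * \<xi> $ l = (\<mu> - \<beta> * d $ l) * R $ l" for l
  proof -
    have "R \<bullet> (diag_matrix d *v R) = (norm R)^2 * m" using R by (simp add: m_def)
    note gradV2_diag_component[OF R this, of l]
    moreover have "((norm R)^2 + 3/2 - 15/2 * m + 3 * d $ l) / norm R ^ 5 = \<xi> \<bullet> \<xi> - \<mu> + \<beta> * d $ l"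
      by (simp add: \<mu>_def \<beta>_def add_divide_distrib)
    ultimately have "gradV2 (diag_matrix d) R $ l = (\<xi> \<bullet> \<xi> - \<mu> + \<beta> * d $ l) * R $ l"
      by (simp only:)
    then have "(\<xi> \<bullet> \<xi>) * R $ l - c * \<xi> $ l = (\<xi> \<bullet> \<xi> - \<mu> + \<beta> * d $ l) * R $ l"
      by (simp add: eq2)
    then show ?thesis by (simp add: algebra_simps)
  qed
  have quad: "(d $ l - \<nu>) * (\<mu> - \<beta> * d $ l) = c^2" if "R $ l \<noteq> 0" for l
  proof -
    have "c^2 * R $ l = c * ((d $ l - \<nu>) * \<xi> $ l)"
      by (simp add: power2_eq_square cR)
    also have "\<dots> = (d $ l - \<nu>) * (\<mu> - \<beta> * d $ l) * R $ l"
      by (simp add: mult.left_commute[of c] c\<xi>)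
    finally show ?thesis using that by simp
  qed
  \<comment> \<open>Vieta's formula for the sum of two distinct roots, from subtracting two
    instances of \<open>quad\<close>.\<close>
  have sum: "\<mu> + \<beta> * \<nu> = \<beta> * (d $ i + d $ j)" if "R $ i \<noteq> 0" "R $ j \<noteq> 0" "d $ i \<noteq> d $ j" for i j
  proof -
    have "(d $ i - d $ j) * (\<mu> + \<beta> * \<nu> - \<beta> * (d $ i + d $ j)) = 0"
      using quad[OF that(1)] quad[OF that(2)] by (simp add: algebra_simps)
    then show ?thesis using that by simp
  qed
  have "\<exists>l. R $ l = 0"
  proof (rule ccontr)
    assume "\<not> ?thesis"
    then have "\<beta> * (d $ 1 + d $ 2) = \<beta> * (d $ 1 + d $ 3)"
      using sum[of 1 2] sum[of 1 3] distinct by simp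
    then show False using \<beta> distinct by simp
  qed
  then obtain l where l: "R $ l = 0" by blast
  \<comment> \<open>Non-perpendicularity, \<open>c \<noteq> 0\<close>, carries the vanishing
    component from \<open>R\<close> over to \<xi>.\<close>
  then have "\<xi> $ l = 0" using c\<xi>[of l] c by simp
  moreover have "\<exists>i j :: 3. i \<noteq> j \<and> (\<forall>k. k \<noteq> i \<longrightarrow> k \<noteq> j \<longrightarrow> k = l)"
    using exhaust_3[of l]
  proof (elim disjE)
    assume "l = 1" then show ?thesis by (intro exI[of _ 2] exI[of _ 3]) (simp add: forall_3)
  next
    assume "l = 2" then show ?thesis by (intro exI[of _ 1] exI[of _ 3]) (simp add: forall_3)
  next
    assume "l = 3" then show ?thesis by (intro exI[of _ 1] exI[of _ 2]) (simp add: forall_3)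
  qed
  ultimately show ?thesis using l unfolding mem_coordinate_plane_iff by metis
qed

section \<open>Conical equilibria inside a principal plane\<close>

text \<open>\<open>D\<close> is the planar determinant and \<open>c\<close> the inner product, so
  \<open>D \<noteq> 0\<close> and \<open>c \<noteq> 0\<close> express the conical condition. In the
  plane \<open>(\<xi> \<bullet> \<xi>) *\<^sub>R R - c *\<^sub>R \<xi>\<close> is \<open>D\<close>
  times the quarter turn of \<xi>.\<close>

lemma conical_coordinate_plane_iff:
  fixes d R \<xi> :: "real^3" and i j :: 3
  defines "D \<equiv> \<xi> $ i * R $ j - \<xi> $ j * R $ i"
    and "c \<equiv> R $ i * \<xi> $ i + R $ j * \<xi> $ j"
    and "g \<equiv> gradV2 (diag_matrix d) R"
  assumes ij: "i \<noteq> j" and R: "R \<in> coordinate_plane i j" and \<xi>: "\<xi> \<in> coordinate_plane i j"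
  shows "conical_relative_equilibrium (diag_matrix d) R \<xi> \<longleftrightarrow>
    D \<noteq> 0 \<and> c \<noteq> 0 \<and> (d $ j - d $ i) * \<xi> $ i * \<xi> $ j = c * D \<and>
    g $ i = - \<xi> $ j * D \<and> g $ j = \<xi> $ i * D"
proof -
  have c: "R \<bullet> \<xi> = c" by (simp add: inner_coordinate_plane[OF ij R] c_def)
  have coll: "collinear {0, R, \<xi>} \<longleftrightarrow> D = 0"
    unfolding cross_eq_0[symmetric] cross3_eq_0_iff_coordinate_plane[OF ij R \<xi>]
    by (auto simp: D_def algebra_simps)
  have "diag_matrix d *v \<xi> - c *\<^sub>R R \<in> coordinate_plane i j"
    using R \<xi> by (simp add: mem_coordinate_plane_iff diag_matrix_mult_component)
  from cross3_eq_0_iff_coordinate_plane[OF ij \<xi> this]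
  have eq1: "cross3 \<xi> (diag_matrix d *v \<xi> - c *\<^sub>R R) = 0 \<longleftrightarrow> (d $ j - d $ i) * \<xi> $ i * \<xi> $ j = c * D"
    by (simp add: diag_matrix_mult_component D_def algebra_simps)
  have rhs: "(\<xi> \<bullet> \<xi>) *\<^sub>R R - c *\<^sub>R \<xi> \<in> coordinate_plane i j"
    using R \<xi> by (simp add: mem_coordinate_plane_iff)
  have "g = (\<xi> \<bullet> \<xi>) *\<^sub>R R - c *\<^sub>R \<xi> \<longleftrightarrow>
      g $ i = ((\<xi> \<bullet> \<xi>) *\<^sub>R R - c *\<^sub>R \<xi>) $ i \<and> g $ j = ((\<xi> \<bullet> \<xi>) *\<^sub>R R - c *\<^sub>R \<xi>) $ j"
    using coordinate_plane_eqI[OF _ rhs] gradV2_diag_coordinate_plane[OF R] by (auto simp: g_def)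
  also have "\<dots> \<longleftrightarrow> g $ i = - \<xi> $ j * D \<and> g $ j = \<xi> $ i * D"
    by (simp add: inner_coordinate_plane[OF ij \<xi>] c_def D_def algebra_simps)
  finally have eq2: "g = (\<xi> \<bullet> \<xi>) *\<^sub>R R - c *\<^sub>R \<xi> \<longleftrightarrow> g $ i = - \<xi> $ j * D \<and> g $ j = \<xi> $ i * D" .
  have "D \<noteq> 0 \<Longrightarrow> R \<noteq> 0" by (auto simp: D_def)
  then show ?thesis
    unfolding conical_relative_equilibrium_def relative_equilibrium_iff[OF transpose_diag_matrix]
      orthogonal_def c coll eq1 eq2[unfolded g_def] g_def by blast
qed


text \<open>Since \<open>g\<close> is \<open>D\<close> times the quarter turn of \<xi>, it follows
  that \<open>g \<bullet> R = D^2\<close>, and \<xi> is recovered from \<open>g\<close> with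
  \<open>k = - D\<close>. Substituting this into the attitude condition eliminates \<xi>.\<close>

lemma conical_coordinate_planeD:
  fixes d R \<xi> :: "real^3" and i j :: 3
  defines "g \<equiv> gradV2 (diag_matrix d) R"
  assumes ij: "i \<noteq> j" and R: "R \<in> coordinate_plane i j" and \<xi>: "\<xi> \<in> coordinate_plane i j"
    and con: "conical_relative_equilibrium (diag_matrix d) R \<xi>"
  shows "g \<bullet> R > 0"
    and "\<exists>k. k \<noteq> 0 \<and> \<xi> = inverse k *\<^sub>R (- g $ j *\<^sub>R axis i 1 + g $ i *\<^sub>R axis j 1) \<and> k^2 = g \<bullet> R"
    and "(d $ j - d $ i) * (g $ i * g $ j) = (g $ i * R $ j - g $ j * R $ i) * (g \<bullet> R)"
    and "R $ i \<noteq> 0" "R $ j \<noteq> 0"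
proof -
  define D where "D = \<xi> $ i * R $ j - \<xi> $ j * R $ i"
  define c where "c = R $ i * \<xi> $ i + R $ j * \<xi> $ j"
  have D: "D \<noteq> 0" and c: "c \<noteq> 0" and eq1: "(d $ j - d $ i) * \<xi> $ i * \<xi> $ j = c * D"
    and gi: "g $ i = - \<xi> $ j * D" and gj: "g $ j = \<xi> $ i * D"
    using con unfolding conical_coordinate_plane_iff[OF ij R \<xi>] by (simp_all add: D_def c_def g_def)
  have g: "g \<in> coordinate_plane i j"
    unfolding g_def by (rule gradV2_diag_coordinate_plane[OF R])
  have gR: "g \<bullet> R = D^2"
    by (simp add: inner_coordinate_plane[OF ij g] gi gj D_def power2_eq_square algebra_simps)
  then show "g \<bullet> R > 0" using D by simp
  have "\<xi> = inverse (- D) *\<^sub>R (- g $ j *\<^sub>R axis i 1 + g $ i *\<^sub>R axis j 1)"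
    using D ij \<xi> by (auto simp: vec_eq_iff axis_def gi gj mem_coordinate_plane_iff)
  then show "\<exists>k. k \<noteq> 0 \<and> \<xi> = inverse k *\<^sub>R (- g $ j *\<^sub>R axis i 1 + g $ i *\<^sub>R axis j 1) \<and> k^2 = g \<bullet> R"
    using D gR by (intro exI[of _ "- D"]) simp
  have "(d $ j - d $ i) * (g $ i * g $ j) = - ((d $ j - d $ i) * \<xi> $ i * \<xi> $ j) * D^2"
    by (simp add: gi gj power2_eq_square)
  also have "\<dots> = (g $ i * R $ j - g $ j * R $ i) * (g \<bullet> R)"
    unfolding eq1 gR by (simp add: gi gj c_def algebra_simps)
  finally show "(d $ j - d $ i) * (g $ i * g $ j) = (g $ i * R $ j - g $ j * R $ i) * (g \<bullet> R)" .
  have "R \<noteq> 0" using D by (auto simp: D_def)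
  then have "g $ l = 0" if "R $ l = 0" for l
    using gradV2_diag_component[of R d "R \<bullet> (diag_matrix d *v R) / (norm R)^2" l] that
    by (simp add: g_def)
  \<comment> \<open>A zero component of \<open>R\<close> forces that component of \<open>g\<close>
    to vanish, hence the other component of \<xi>, and then \<open>c = 0\<close>.\<close>
  from this[of i] this[of j] show "R $ i \<noteq> 0" "R $ j \<noteq> 0"
    using gi gj D c by (auto simp: c_def)
qed

text \<open>The quarter turn of \<open>g\<close>, divided by \<open>sqrt (g \<bullet> R)\<close>,
  serves as \<xi>: its determinant with \<open>R\<close> is \<open>- k\<close>, and
  \<open>cross\<close> makes its inner product with \<open>R\<close> nonzero.\<close>

lemma conical_coordinate_planeI:
  fixes d R :: "real^3" and i j :: 3
  defines "g \<equiv> gradV2 (diag_matrix d) R"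
  assumes ij: "i \<noteq> j" and R: "R \<in> coordinate_plane i j"
    and gR: "g \<bullet> R > 0"
    and cross: "g $ i * R $ j \<noteq> g $ j * R $ i"
    and eq: "(d $ j - d $ i) * (g $ i * g $ j) = (g $ i * R $ j - g $ j * R $ i) * (g \<bullet> R)"
  shows "\<exists>\<xi>. conical_relative_equilibrium (diag_matrix d) R \<xi>"
proof -
  \<comment> \<open>By Lagrange's identity in the plane, the formula for \<open>k\<^sup>2\<close> reduces to \<open>g \<bullet> R\<close>.\<close>
  define k where "k = sqrt (g \<bullet> R)"
  have k: "k \<noteq> 0" and k2: "k * k = g \<bullet> R" using gR by (simp_all add: k_def)
  define \<xi> where "\<xi> = inverse k *\<^sub>R (- g $ j *\<^sub>R axis i 1 + g $ i *\<^sub>R axis j 1 :: real^3)"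
  have \<xi>i: "\<xi> $ i = - g $ j / k" and \<xi>j: "\<xi> $ j = g $ i / k" and \<xi>: "\<xi> \<in> coordinate_plane i j"
    using ij by (simp_all add: \<xi>_def axis_def divide_inverse mem_coordinate_plane_iff)
  have g: "g \<in> coordinate_plane i j"
    unfolding g_def by (rule gradV2_diag_coordinate_plane[OF R])
  have D: "\<xi> $ i * R $ j - \<xi> $ j * R $ i = - k"
  proof -
    have "\<xi> $ i * R $ j - \<xi> $ j * R $ i = - (g \<bullet> R) / k"
      by (simp add: \<xi>i \<xi>j inner_coordinate_plane[OF ij g] diff_divide_distrib)
    then show ?thesis using k by (simp flip: k2)
  qed
  have c: "R $ i * \<xi> $ i + R $ j * \<xi> $ j = (g $ i * R $ j - g $ j * R $ i) / k"
    by (simp add: \<xi>i \<xi>j diff_divide_distrib mult.commute)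
  have "(d $ j - d $ i) * \<xi> $ i * \<xi> $ j = - ((d $ j - d $ i) * (g $ i * g $ j)) / (k * k)"
    by (simp add: \<xi>i \<xi>j)
  also have "\<dots> = (g $ i * R $ j - g $ j * R $ i) / k * - k"
    using k gR by (simp add: eq k2)
  finally have "conical_relative_equilibrium (diag_matrix d) R \<xi>"
    unfolding conical_coordinate_plane_iff[OF ij R \<xi>] D c g_def[symmetric]
    using k cross by (simp add: \<xi>i \<xi>j)
  then show ?thesis by blast
qed

section \<open>The quadratic equation for the direction of \<open>R\<close>\<close>

text \<open>\<open>S\<close> plays the role of the squared cosine, and \<open>m\<close> is the mean
  of the two moments weighted by the direction of \<open>R\<close>. Both sides of the equation share
  a nonzero factor; cancelling it leaves a polynomial condition.\<close>

lemma conical_equation_in_coordinate_plane: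
  fixes d R :: "real^3" and i j :: 3 and S :: real
  defines "g \<equiv> gradV2 (diag_matrix d) R" and "r \<equiv> norm R" and "m \<equiv> d $ i * S + d $ j * (1 - S)"
  assumes ij: "i \<noteq> j" and R: "R \<in> coordinate_plane i j"
    and RS: "(R $ i)^2 = r^2 * S" "(R $ j)^2 = r^2 * (1 - S)"
    and R0: "R $ i \<noteq> 0" "R $ j \<noteq> 0"
    and dij: "d $ i \<noteq> d $ j"
  shows "g \<bullet> R = (r^2 + 3/2 - 9/2 * m) / r^3"
    and "g $ i * R $ j \<noteq> g $ j * R $ i"
    and "(d $ j - d $ i) * (g $ i * g $ j) = (g $ i * R $ j - g $ j * R $ i) * (g \<bullet> R) \<longleftrightarrow>
      (r^2 + 3/2 - 15/2 * m + 3 * d $ i) * (r^2 + 3/2 - 15/2 * m + 3 * d $ j)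
        + 3 * r^2 * (r^2 + 3/2 - 9/2 * m) = 0"
proof -
  \<comment> \<open>The part of the gradient factor common to both axes; the radial component
    involves \<open>u + 3 * m\<close>.\<close>
  define u where "u = r^2 + 3/2 - 15/2 * m"
  have "R \<noteq> 0" using R0 by auto
  then have r: "r \<noteq> 0" by (simp add: r_def)
  have "R \<bullet> (diag_matrix d *v R) = d $ i * (R $ i)^2 + d $ j * (R $ j)^2"
    by (simp add: inner_coordinate_plane[OF ij R] diag_matrix_mult_component power2_eq_square)
  also have "\<dots> = r^2 * m" by (simp add: RS m_def algebra_simps)
  finally have gl: "g $ l = (u + 3 * d $ l) / r^5 * R $ l" for l
    using gradV2_diag_component[OF \<open>R \<noteq> 0\<close>, of d m l] by (simp add: g_def r_def u_def)
  have "g \<bullet> R = (u + 3 * d $ i) / r^5 * (R $ i)^2 + (u + 3 * d $ j) / r^5 * (R $ j)^2"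
    using inner_coordinate_plane[OF ij R, of g]
    by (simp add: inner_commute[of g] gl power2_eq_square ac_simps)
  also have "\<dots> = (u + 3 * m) / r^3"
    unfolding RS using r by (simp add: m_def field_simps power_numeral_reduce)
  finally have gR: "g \<bullet> R = (u + 3 * m) / r^3" .
  then show "g \<bullet> R = (r^2 + 3/2 - 9/2 * m) / r^3" by (simp add: u_def)
  have cross: "g $ i * R $ j - g $ j * R $ i = - 3 * (d $ j - d $ i) * R $ i * R $ j / r^5"
    by (simp add: gl diff_divide_distrib add_divide_distrib algebra_simps)
  then show "g $ i * R $ j \<noteq> g $ j * R $ i" using dij r R0 by auto
  define P where "P = R $ i * R $ j / r^10"
  have "g $ i * g $ j = P * ((u + 3 * d $ i) * (u + 3 * d $ j))"
    by (simp add: gl P_def flip: power_add)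
  moreover have "(g $ i * R $ j - g $ j * R $ i) * (g \<bullet> R) =
      - (d $ j - d $ i) * P * (3 * r^2 * (u + 3 * m))"
    unfolding cross gR P_def using r by (simp add: divide_simps power_numeral_reduce) (simp add: algebra_simps)
  ultimately have "(d $ j - d $ i) * (g $ i * g $ j) - (g $ i * R $ j - g $ j * R $ i) * (g \<bullet> R) =
      (d $ j - d $ i) * P * ((u + 3 * d $ i) * (u + 3 * d $ j) + 3 * r^2 * (u + 3 * m))"
    by (simp add: algebra_simps)
  then show "(d $ j - d $ i) * (g $ i * g $ j) = (g $ i * R $ j - g $ j * R $ i) * (g \<bullet> R) \<longleftrightarrow>
      (r^2 + 3/2 - 15/2 * m + 3 * d $ i) * (r^2 + 3/2 - 15/2 * m + 3 * d $ j)
        + 3 * r^2 * (r^2 + 3/2 - 9/2 * m) = 0"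
    using dij r R0 by (subst eq_iff_diff_eq_0) (simp add: u_def P_def)
qed

text \<open>The factor 4 clears denominators; sorting by powers of \<open>S\<close> gives
  \<open>A4\<close>, \<open>A2\<close> and \<open>A0\<close>, with \<open>x\<close> the squared
  radius.\<close>

lemma conical_polynomial:
  fixes x a b S :: real
  shows "4 * ((x + 3/2 - 15/2 * (a * S + b * (1 - S)) + 3 * a) * (x + 3/2 - 15/2 * (a * S + b * (1 - S)) + 3 * b)
      + 3 * x * (x + 3/2 - 9/2 * (a * S + b * (1 - S)))) =
    225 * (b - a)^2 * S^2 + 6 * (b - a) * (19 * x + 15 * a - 60 * b + 15) * S
      + (2 * x - 9 * b + 3) * (8 * x + 6 * a - 15 * b + 3)"
  by (simp add: field_simps power2_eq_square)

section \<open>Existence by the intermediate value theorem\<close>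

text \<open>At a fixed radius, \<open>F\<close> changes sign as \<open>m\<close> runs from
  \<open>d $ i\<close> to \<open>M\<close>. A root strictly between them fixes the direction of
  \<open>R\<close> and keeps the radial component of the gradient positive.\<close>

lemma conical_exists_in_coordinate_plane:
  fixes d :: "real^3" and i j :: 3
  assumes "d $ i < 1/3" "1/3 < d $ j"
  shows "\<exists>R \<xi>. conical_relative_equilibrium (diag_matrix d) R \<xi>"
proof -
  have ij: "i \<noteq> j" using assms by auto
  \<comment> \<open>With this squared radius \<open>x\<close>, \<open>g \<bullet> R\<close> has the sign of \<open>M - m\<close>, where
    \<open>m = (R \<bullet> I R) / |R|\<^sup>2\<close> and \<open>M\<close> lies strictly between the two moments.\<close>
  define x where "x = (9 * d $ j - 3) / 4"
  define r where "r = sqrt x"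
  have x: "x > 0" using assms by (simp add: x_def)
  then have r: "r > 0" and r2: "r^2 = x" by (simp_all add: r_def)
  define F where "F = (\<lambda>m. (x + 3/2 - 15/2 * m + 3 * d $ i) * (x + 3/2 - 15/2 * m + 3 * d $ j)
        + 3 * x * (x + 3/2 - 9/2 * m))"
  define M where "M = (d $ j + 1/3) / 2"
  have xM: "x + 3/2 = 9/2 * M" by (simp add: x_def M_def field_simps)
  have M: "d $ i < M" "M < d $ j" using assms by (simp_all add: M_def)
  \<comment> \<open>At \<open>M\<close> the last summand of \<open>F\<close> vanishes and the two
    factors become \<open>3 * (d $ i - M)\<close> and \<open>3 * (d $ j - M)\<close>.\<close>
  have "F M = 9 * ((d $ i - M) * (d $ j - M))"
    unfolding F_def xM by (simp add: algebra_simps)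
  then have FM: "F M < 0" using M by (simp add: mult_less_0_iff)
  \<comment> \<open>This is \<open>A0 / 4\<close> with the two axes interchanged; both factors are
    positive because the moments lie on either side of \<open>1/3\<close>.\<close>
  have "F (d $ i) = (2 * x - 9 * d $ i + 3) * (8 * x + 6 * d $ j - 15 * d $ i + 3) / 4"
    by (simp add: F_def field_simps)
  also have "\<dots> > 0" using assms x by simp
  finally have Fi: "F (d $ i) > 0" .
  have "\<exists>m\<ge>d $ i. m \<le> M \<and> F m = 0"
    using Fi FM M by (intro IVT2') (auto simp: F_def intro!: continuous_intros)
  then obtain m where Fm: "F m = 0" and "d $ i \<le> m" "m \<le> M" by auto
  then have m: "d $ i < m" "m < M" using Fi FM by (auto simp: less_le)
  \<comment> \<open>Solves \<open>m = d $ i * S + d $ j * (1 - S)\<close>; strictness of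
    \<open>d $ i < m < d $ j\<close> makes both components of \<open>R\<close> nonzero.\<close>
  define S where "S = (d $ j - m) / (d $ j - d $ i)"
  have S: "0 < S" "S < 1" using m M by (simp_all add: S_def)
  have "d $ i * S + d $ j * (1 - S) = d $ j - S * (d $ j - d $ i)" by (simp add: algebra_simps)
  also have "\<dots> = m" using M by (simp add: S_def)
  finally have mS: "d $ i * S + d $ j * (1 - S) = m" .
  define R where "R = (r * sqrt S) *\<^sub>R axis i 1 + (r * sqrt (1 - S)) *\<^sub>R (axis j 1 :: real^3)"
  have Rij: "R $ i = r * sqrt S" "R $ j = r * sqrt (1 - S)" and R: "R \<in> coordinate_plane i j"
    using ij by (simp_all add: R_def axis_def mem_coordinate_plane_iff)
  have "R \<bullet> R = r^2"
    using S by (simp add: inner_coordinate_plane[OF ij R] Rij power2_eq_square[symmetric]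
        power_mult_distrib algebra_simps)
  then have norm: "norm R = r" using r by (simp add: norm_eq_sqrt_inner)
  have "(R $ i)^2 = (norm R)^2 * S" "(R $ j)^2 = (norm R)^2 * (1 - S)" "R $ i \<noteq> 0" "R $ j \<noteq> 0" "d $ i \<noteq> d $ j"
    using S r assms by (simp_all add: Rij norm power_mult_distrib)
  note * = conical_equation_in_coordinate_plane[OF ij R this, unfolded mS norm r2, folded F_def]
  have "gradV2 (diag_matrix d) R \<bullet> R > 0"
    unfolding *(1) xM using m r by simp
  then show ?thesis
    using conical_coordinate_planeI[OF ij R _ *(2)] *(3) Fm by (auto simp: F_def)
qed

theorem proposition3p4:
  fixes I :: "real^3"
  assumes distinct: "I $ 1 \<noteq> I $ 2" "I $ 1 \<noteq> I $ 3" "I $ 2 \<noteq> I $ 3"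
    and bounds: "\<forall>i. 0 < I $ i \<and> I $ i < 1/2"
    and trace: "I $ 1 + I $ 2 + I $ 3 = 1"
  shows "(\<exists>R \<xi>. conical_relative_equilibrium (diag_matrix I) R \<xi>) \<and>
    (\<forall>R \<xi>. conical_relative_equilibrium (diag_matrix I) R \<xi> \<longrightarrow>
      (\<exists>i j. i \<noteq> j \<and> R \<in> coordinate_plane i j \<and> \<xi> \<in> coordinate_plane i j) \<and>
      (\<forall>i j. i \<noteq> j \<and> R \<in> coordinate_plane i j \<and> \<xi> \<in> coordinate_plane i j \<longrightarrow>
        (let r = norm R; g = grad (V2 (diag_matrix I)) R; I1 = I $ i; I2 = I $ j;
             A4 = 225 * (I2 - I1)^2;
             A2 = 6 * (I2 - I1) * (19 * r^2 + 15 * I1 - 60 * I2 + 15);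
             A0 = (2 * r^2 - 9 * I2 + 3) * (8 * r^2 + 6 * I1 - 15 * I2 + 3);
             g1 = g $ i; g2 = g $ j
         in (\<forall>\<psi>. R = (r * cos \<psi>) *\<^sub>R axis i 1 + (r * sin \<psi>) *\<^sub>R axis j 1 \<longrightarrow>
               (let S = (cos \<psi>)^2 in A4 * S^2 + A2 * S + A0 = 0)) \<and>
            g \<bullet> R > 0 \<and>
            g = g1 *\<^sub>R axis i 1 + g2 *\<^sub>R axis j 1 \<and>
            (\<exists>k. k \<noteq> 0 \<and>
               \<xi> = inverse k *\<^sub>R (- g2 *\<^sub>R axis i 1 + g1 *\<^sub>R axis j 1) \<and>
               k^2 = (r^2 * (norm g)^2 - ((g2 *\<^sub>R axis i 1 - g1 *\<^sub>R axis j 1) \<bullet> R)^2) / (g \<bullet> R)))))"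
proof (intro conjI allI impI)
  \<comment> \<open>The moments have mean \<open>1/3\<close> and are distinct, so some lie strictly
    below it and some strictly above.\<close>
  have "\<exists>i. I $ i < 1/3"
  proof (rule ccontr)
    assume "\<nexists>i. I $ i < 1/3"
    then have "I $ 1 \<ge> 1/3" "I $ 2 \<ge> 1/3" "I $ 3 \<ge> 1/3" by (simp_all add: not_less)
    then show False using trace distinct by linarith
  qed
  moreover have "\<exists>j. 1/3 < I $ j"
  proof (rule ccontr)
    assume "\<nexists>j. 1/3 < I $ j"
    then have "I $ 1 \<le> 1/3" "I $ 2 \<le> 1/3" "I $ 3 \<le> 1/3" by (simp_all add: not_less)
    then show False using trace distinct by linarith
  qed
  ultimately show "\<exists>R \<xi>. conical_relative_equilibrium (diag_matrix I) R \<xi>"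
    using conical_exists_in_coordinate_plane by blast
next
  fix R \<xi> assume con: "conical_relative_equilibrium (diag_matrix I) R \<xi>"
  then show "\<exists>i j. i \<noteq> j \<and> R \<in> coordinate_plane i j \<and> \<xi> \<in> coordinate_plane i j"
    by (rule conical_in_coordinate_plane[OF distinct])
  fix i j assume "i \<noteq> j \<and> R \<in> coordinate_plane i j \<and> \<xi> \<in> coordinate_plane i j"
  then have ij: "i \<noteq> j" and R: "R \<in> coordinate_plane i j" and \<xi>: "\<xi> \<in> coordinate_plane i j" by auto
  define g where "g = gradV2 (diag_matrix I) R"
  note * = conical_coordinate_planeD[OF ij R \<xi> con, folded g_def]
  have "R \<noteq> 0" using *(4) by auto
  then have grad: "grad (V2 (diag_matrix I)) R = g"
    unfolding g_def by (intro grad_eqI GDERIV_V2 transpose_diag_matrix)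
  have g: "g \<in> coordinate_plane i j"
    unfolding g_def by (rule gradV2_diag_coordinate_plane[OF R])
  have g_expand: "g = g $ i *\<^sub>R axis i 1 + g $ j *\<^sub>R axis j 1"
    by (rule coordinate_plane_expand[OF ij g])
  have "I $ i \<noteq> I $ j"
    using distinct ij exhaust_3[of i] exhaust_3[of j] by auto
  have S: "225 * (I $ j - I $ i)^2 * ((cos \<psi>)^2)^2
      + 6 * (I $ j - I $ i) * (19 * (norm R)^2 + 15 * I $ i - 60 * I $ j + 15) * (cos \<psi>)^2
      + (2 * (norm R)^2 - 9 * I $ j + 3) * (8 * (norm R)^2 + 6 * I $ i - 15 * I $ j + 3) = 0"
    if \<psi>: "R = (norm R * cos \<psi>) *\<^sub>R axis i 1 + (norm R * sin \<psi>) *\<^sub>R axis j 1" for \<psi>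
  proof -
    have Rij: "R $ i = norm R * cos \<psi>" "R $ j = norm R * sin \<psi>"
      using ij by (subst \<psi>, simp add: axis_def)+
    then have "(R $ i)^2 = (norm R)^2 * (cos \<psi>)^2" "(R $ j)^2 = (norm R)^2 * (1 - (cos \<psi>)^2)"
      by (simp_all add: power_mult_distrib sin_squared_eq)
    from conical_equation_in_coordinate_plane(3)[OF ij R this *(4,5) \<open>I $ i \<noteq> I $ j\<close>] *(3)
    have "((norm R)^2 + 3/2 - 15/2 * (I $ i * (cos \<psi>)^2 + I $ j * (1 - (cos \<psi>)^2)) + 3 * I $ i)
        * ((norm R)^2 + 3/2 - 15/2 * (I $ i * (cos \<psi>)^2 + I $ j * (1 - (cos \<psi>)^2)) + 3 * I $ j)
        + 3 * (norm R)^2 * ((norm R)^2 + 3/2 - 9/2 * (I $ i * (cos \<psi>)^2 + I $ j * (1 - (cos \<psi>)^2))) = 0"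
      unfolding g_def by simp
    then show ?thesis
      using conical_polynomial[of "(norm R)^2" "I $ i" "(cos \<psi>)^2" "I $ j"] by simp
  qed
  \<comment> \<open>Lagrange's identity in the plane: the numerator of the formula for
    \<open>k^2\<close> is a square, so the quotient is \<open>g \<bullet> R\<close>.\<close>
  have lagrange: "(norm R)^2 * (norm g)^2 - ((g $ j *\<^sub>R axis i 1 - g $ i *\<^sub>R axis j 1) \<bullet> R)^2 = (g \<bullet> R)^2"
    unfolding power2_norm_eq_inner
    by (simp add: inner_coordinate_plane[OF ij R] inner_coordinate_plane[OF ij g]
        inner_diff_left inner_axis' power2_eq_square algebra_simps)
  show "let r = norm R; g = grad (V2 (diag_matrix I)) R; I1 = I $ i; I2 = I $ j;
             A4 = 225 * (I2 - I1)^2;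
             A2 = 6 * (I2 - I1) * (19 * r^2 + 15 * I1 - 60 * I2 + 15);
             A0 = (2 * r^2 - 9 * I2 + 3) * (8 * r^2 + 6 * I1 - 15 * I2 + 3);
             g1 = g $ i; g2 = g $ j
         in (\<forall>\<psi>. R = (r * cos \<psi>) *\<^sub>R axis i 1 + (r * sin \<psi>) *\<^sub>R axis j 1 \<longrightarrow>
               (let S = (cos \<psi>)^2 in A4 * S^2 + A2 * S + A0 = 0)) \<and>
            g \<bullet> R > 0 \<and>
            g = g1 *\<^sub>R axis i 1 + g2 *\<^sub>R axis j 1 \<and>
            (\<exists>k. k \<noteq> 0 \<and>
               \<xi> = inverse k *\<^sub>R (- g2 *\<^sub>R axis i 1 + g1 *\<^sub>R axis j 1) \<and>
               k^2 = (r^2 * (norm g)^2 - ((g2 *\<^sub>R axis i 1 - g1 *\<^sub>R axis j 1) \<bullet> R)^2) / (g \<bullet> R))"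
    unfolding Let_def grad lagrange
  proof (intro conjI allI impI)
    show "\<exists>k. k \<noteq> 0 \<and> \<xi> = inverse k *\<^sub>R (- g $ j *\<^sub>R axis i 1 + g $ i *\<^sub>R axis j 1) \<and>
        k^2 = (g \<bullet> R)^2 / (g \<bullet> R)"
      using *(1,2) by (simp add: power2_eq_square[of "g \<bullet> R"])
  qed (fact S *(1) g_expand)+
qed

end
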